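(* Let $\{\mathcal{F}_R\}$ be a family of $L$-functions indexed by a parameter $R\to\infty$, each $\mathcal{F}_R$ a finite set of $L$-functions $L(s,f)$ with analytic conductors $N_f$. Assume the Generalized Riemann Hypothesis, so that the non-trivial zeros of each $L(s,f)$ are $\frac12+i\gamma_f^{(j)}$ with $\gamma_f^{(j)}\in\mathbb{R}$. For $\tau>0$ define $$Z^{(\mathrm{local})}_{R}(\tau)=\frac{1}{|\mathcal{F}_R|}\sum_{f\in\mathcal{F}_R}\#\Big\{j:\ \gamma_f^{(j)}\tfrac{\log N_f}{2\pi}\in[-\tau,\tau]\Big\},\qquad Z^{(\mathrm{global})}_{R}(\tau)=\frac{1}{|\mathcal{F}_R|}\sum_{f\in\mathcal{F}_R}\#\Big\{j:\ \gamma_f^{(j)}\tfrac{\log N}{2\pi}\in[-\tau,\tau]\Big\},$$ where $\frac{\log N}{2\pi}=\frac{1}{|\mathcal{F}_R|}\sum_{f\in\mathcal{F}_R}\frac{\log N_f}{2\pi}$. Correspondingly define the one-level densities $$D^{\mathrm{local}}_{\mathcal{F}_R}(\phi)=\frac{1}{|\mathcal{F}_R|}\sum_{f\in\mathcal{F}_R}\sum_j\phi\Big(\gamma_f^{(j)}\tfrac{\log N_f}{2\pi}\Big),\qquad D^{\mathrm{global}}_{\mathcal{F}_R}(\phi)=\frac{1}{|\mathcal{F}_R|}\sum_{f\in\mathcal{F}_R}\sum_j\phi\Big(\gamma_f^{(j)}\tfrac{\log N}{2\pi}\Big).$$ Let $\sigma>0$ and assume there are constants $a,b$ such that, for both normalizations,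 $$D_{\mathcal{F}_R}(\phi)=a\,\phi(0)+b\,\widehat{\phi}(0)+O\Big(\frac{\log\log R}{\log R}\Big)$$ whenever $\phi$ is an even twice continuously differentiable function whose Fourier transform $\widehat\phi(y)=\int_{-\infty}^{\infty}\phi(x)e^{-2\pi i xy}\,dx$ is supported in $(-\sigma,\sigma)$. Fix $\tau>0$. (1) If $\phi$ is such a function with $\phi(x)\ge0$ for $|x|\le\tau$, $\phi(x)\le 0$ for $|x|\ge\tau$, and $\phi$ attains its maximum at $x=0$, then $$Z^{(\mathrm{global})}_{R}(\tau),\ Z^{(\mathrm{local})}_{R}(\tau)\ \ge\ a+b\,\frac{\widehat\phi(0)}{\phi(0)}+O\Big(\frac{\log\log R}{\phi(0)\log R}\Big).$$ (2) If $\psi$ is such a function with $\psi(x)\ge0$ for all $x$ and $\psi$ monotonically decreasing on $(0,\tau)$, then $$Z^{(\mathrm{global})}_{R}(\tau),\ Z^{(\mathrm{local})}_{R}(\tau)\ \le\ a+\frac{a(\psi(0)-\psi(\tau))+b\,\widehat\psi(0)}{\psi(\tau)}+O\Big(\frac{\log\log R}{\psi(0)\log R}\Big).$$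
   Context: The Fourier transform is normalized as $\widehat\phi(y)=\int\phi(x)e^{-2\pi ixy}dx$. Implied constants in $O(\cdot)$ may depend on the test function; asymptotics are as $R\to\infty$. *)

theory Defs
  imports
    "HOL-Complex_Analysis.Complex_Analysis"
    "HOL-Computational_Algebra.Primes"
    "HOL-Library.Landau_Symbols"
begin

section \<open>L-functions\<close>

text \<open>
  L-functions are taken in the analytic normalization, with critical line Re s = 1/2, following
  Iwaniec and Kowalski, Analytic Number Theory, Section 5.1. The field \<open>completed\<close> holds the
  analytic continuation of the completed L-function; its values at 0 and 1, where it may
  have poles, are irrelevant. The local roots and the gamma shifts are indexed by i < deg.
\<close>

record lfunction =
  deg :: nat
  dcoeff :: "nat \<Rightarrow> complex"
  local_root :: "nat \<Rightarrow> nat \<Rightarrow> complex"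
  gamma_shift :: "nat \<Rightarrow> complex"
  conductor :: nat
  root_number :: complex
  completed :: "complex \<Rightarrow> complex"

text \<open>
  L(s,f) is the completed function divided by the conductor power and the gamma factor. Writing
  the reciprocal of the gamma factor with \<^const>\<open>rGamma\<close> gives the correct value (usually a
  trivial zero) also where the gamma factor has a pole.
\<close>

definition L_value :: "lfunction \<Rightarrow> complex \<Rightarrow> complex" where
  "L_value f s =
     completed f s * of_nat (conductor f) powr (- s / 2)
       * of_real pi powr (of_nat (deg f) * s / 2)
       * (\<Prod>i<deg f. rGamma ((s + gamma_shift f i) / 2))"

definition euler_factor :: "lfunction \<Rightarrow> complex \<Rightarrow> nat \<Rightarrow> complex" where
  "euler_factor f s p = (\<Prod>i<deg f. inverse (1 - local_root f p i * of_nat p powr (- s)))"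

text \<open>
  The functional equation is usually written with the dual of f on the right-hand side, whose
  completed function is s \<open>\<mapsto>\<close> cnj (completed f (cnj s)). The growth condition says that
  the completed function is, up to poles at 0 and 1, of order at most 1.
\<close>

definition is_L_function :: "lfunction \<Rightarrow> bool" where
  "is_L_function f \<longleftrightarrow>
     deg f \<ge> 1 \<and> conductor f \<ge> 1 \<and> norm (root_number f) = 1 \<and> dcoeff f 1 = 1 \<and>
     (\<forall>p i. prime p \<longrightarrow> i < deg f \<longrightarrow>
        norm (local_root f p i) < real p \<and>
        (\<not> p dvd conductor f \<longrightarrow> local_root f p i \<noteq> 0)) \<and>
     (\<forall>i<deg f. Re (gamma_shift f i) > -1) \<and>
     completed f holomorphic_on (- {0, 1}) \<and>
     (\<forall>s. Re s > 1 \<longrightarrow>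
        ((\<lambda>n. dcoeff f n * of_nat n powr (- s)) has_sum L_value f s) {1..} \<and>
        abs_convergent_prod (\<lambda>p. if prime p then euler_factor f s p else 1) \<and>
        (\<lambda>p. if prime p then euler_factor f s p else 1) has_prod L_value f s) \<and>
     (\<forall>s. s \<noteq> 0 \<longrightarrow> s \<noteq> 1 \<longrightarrow>
        completed f s = root_number f * cnj (completed f (1 - cnj s))) \<and>
     (\<exists>m::nat. \<forall>\<epsilon>>0. \<exists>C. \<forall>s. s \<noteq> 0 \<longrightarrow> s \<noteq> 1 \<longrightarrow>
        norm ((s * (s - 1)) ^ m * completed f s) \<le> C * exp (norm s powr (1 + \<epsilon>)))"

text \<open>The analytic conductor at s = 0, with the shift by 3 of Iwaniec and Kowalski.\<close>

definition analytic_conductor :: "lfunction \<Rightarrow> real" where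
  "analytic_conductor f = real (conductor f) * (\<Prod>i<deg f. (norm (gamma_shift f i) + 3))"

text \<open>
  The non-trivial zeros of L(s,f) are the zeros of the completed function: the others sit at poles
  of the gamma factor. Using \<^const>\<open>zorder\<close> avoids any dependence on the values at 0 and 1.
\<close>

definition nontrivial_zeros :: "lfunction \<Rightarrow> complex set" where
  "nontrivial_zeros f = {\<rho>. zorder (completed f) \<rho> > 0}"

definition GRH :: "lfunction \<Rightarrow> bool" where
  "GRH f \<longleftrightarrow> (\<forall>\<rho>\<in>nontrivial_zeros f. Re \<rho> = 1 / 2)"

text \<open>
  The indices j enumerating the zeros with multiplicity: a zero of order m gives the m indices
  \<open>(\<rho>, 0), \<dots>, (\<rho>, m - 1)\<close>.
\<close>

definition zero_index :: "lfunction \<Rightarrow> (complex \<times> nat) set" where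
  "zero_index f = {(\<rho>, k). \<rho> \<in> nontrivial_zeros f \<and> int k < zorder (completed f) \<rho>}"

definition ordinate :: "complex \<times> nat \<Rightarrow> real" where
  "ordinate j = Im (fst j)"

section \<open>Zero counts and one-level densities\<close>

definition family_avg :: "lfunction set \<Rightarrow> (lfunction \<Rightarrow> real) \<Rightarrow> real" where
  "family_avg A g = (1 / real (card A)) * (\<Sum>f\<in>A. g f)"

definition local_scale :: "lfunction \<Rightarrow> real" where
  "local_scale f = ln (analytic_conductor f) / (2 * pi)"

definition global_scale :: "lfunction set \<Rightarrow> real" where
  "global_scale A = family_avg A local_scale"

definition Z_local :: "lfunction set \<Rightarrow> real \<Rightarrow> real" where
  "Z_local A \<tau> =
     family_avg A (\<lambda>f. real (card {j \<in> zero_index f. ordinate j * local_scale f \<in> {-\<tau>..\<tau>}}))"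

definition Z_global :: "lfunction set \<Rightarrow> real \<Rightarrow> real" where
  "Z_global A \<tau> =
     family_avg A (\<lambda>f. real (card {j \<in> zero_index f. ordinate j * global_scale A \<in> {-\<tau>..\<tau>}}))"

definition D_local :: "lfunction set \<Rightarrow> (real \<Rightarrow> real) \<Rightarrow> real" where
  "D_local A \<phi> = family_avg A (\<lambda>f. \<Sum>\<^sub>\<infinity>j\<in>zero_index f. \<phi> (ordinate j * local_scale f))"

definition D_global :: "lfunction set \<Rightarrow> (real \<Rightarrow> real) \<Rightarrow> real" where
  "D_global A \<phi> = family_avg A (\<lambda>f. \<Sum>\<^sub>\<infinity>j\<in>zero_index f. \<phi> (ordinate j * global_scale A))"

section \<open>Test functions\<close>

definition fourier :: "(real \<Rightarrow> real) \<Rightarrow> real \<Rightarrow> complex" where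
  "fourier \<phi> y = (LINT x|lborel. of_real (\<phi> x) * exp (- 2 * of_real pi * \<i> * of_real x * of_real y))"

definition twice_cont_diff :: "(real \<Rightarrow> real) \<Rightarrow> bool" where
  "twice_cont_diff \<phi> \<longleftrightarrow>
     (\<exists>\<phi>' \<phi>''. (\<forall>x. (\<phi> has_real_derivative \<phi>' x) (at x)) \<and>
               (\<forall>x. (\<phi>' has_real_derivative \<phi>'' x) (at x)) \<and>
               continuous_on UNIV \<phi>'')"

text \<open>
  The one-level densities only make sense if the sums over zeros converge, which does not follow
  from integrability and the support condition alone; an infinite sum that fails to converge
  is 0 by convention in the library. Convergence is therefore part of being a test function
  for the family.
\<close>

definition zero_sums_converge :: "(real \<Rightarrow> lfunction set) \<Rightarrow> (real \<Rightarrow> real) \<Rightarrow> bool" where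
  "zero_sums_converge F \<phi> \<longleftrightarrow>
     (\<forall>\<^sub>F R in at_top. \<forall>f\<in>F R.
        (\<lambda>j. \<phi> (ordinate j * local_scale f)) summable_on zero_index f \<and>
        (\<lambda>j. \<phi> (ordinate j * global_scale (F R))) summable_on zero_index f)"

definition test_function :: "(real \<Rightarrow> lfunction set) \<Rightarrow> real \<Rightarrow> (real \<Rightarrow> real) \<Rightarrow> bool" where
  "test_function F \<sigma> \<phi> \<longleftrightarrow>
     (\<forall>x. \<phi> (- x) = \<phi> x) \<and> twice_cont_diff \<phi> \<and> integrable lborel \<phi> \<and>
     closure {y. fourier \<phi> y \<noteq> 0} \<subseteq> {-\<sigma><..<\<sigma>} \<and>
     zero_sums_converge F \<phi>"

text \<open>The transform at 0 of a real-valued function is real.\<close>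

definition fourier0 :: "(real \<Rightarrow> real) \<Rightarrow> real" where
  "fourier0 \<phi> = Re (fourier \<phi> 0)"

text \<open>\<open>Z \<ge> X + O(g)\<close> and \<open>Z \<le> X + O(g)\<close> as \<open>R \<rightarrow> \<infinity>\<close>.\<close>

definition ge_up_to_O :: "(real \<Rightarrow> real) \<Rightarrow> real \<Rightarrow> (real \<Rightarrow> real) \<Rightarrow> bool" where
  "ge_up_to_O Z X g \<longleftrightarrow> (\<exists>E. E \<in> O[at_top](g) \<and> (\<forall>\<^sub>F R in at_top. Z R \<ge> X + E R))"

definition le_up_to_O :: "(real \<Rightarrow> real) \<Rightarrow> real \<Rightarrow> (real \<Rightarrow> real) \<Rightarrow> bool" where
  "le_up_to_O Z X g \<longleftrightarrow> (\<exists>E. E \<in> O[at_top](g) \<and> (\<forall>\<^sub>F R in at_top. Z R \<le> X + E R))"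

end

theory Submission
  imports Defs
begin

text \<open>
  A test function as in (1) is at most \<open>\<phi>(0)\<close> times the indicator function of \<open>[-\<tau>, \<tau>]\<close>, one
  as in (2) is at least \<open>\<psi>(\<tau>)\<close> times it; summing over the zeros and averaging over the family
  compares the zero counts with the one-level densities. Because the cardinality of an infinite set
  is 0, (1) also needs that only finitely many zeros lie in a bounded window. This holds since the
  Euler product shows that the completed L-function does not vanish identically.
\<close>

section \<open>Zeros of the completed L-function\<close>

text \<open>In the sense of \<open>has_prod\<close>, a product is zero only if one of its factors
  is, so it is enough to look at one Euler factor at a time.\<close>

lemma L_value_nonzero:
  assumes f: "is_L_function f" and s: "Re s > 1"
  shows "L_value f s \<noteq> 0"
proof -
  have prod: "(\<lambda>p. if prime p then euler_factor f s p else 1) has_prod L_value f s"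
    using f s by (simp add: is_L_function_def)
  have "euler_factor f s p \<noteq> 0" if p: "prime p" for p
  proof -
    \<comment> \<open>As \<open>inverse 0 = 0\<close>, a factor vanishes exactly when some
      denominator does. This would need a local root of norm \<open>p powr Re s\<close>, but local
      roots have norm below \<open>p\<close> and \<open>Re s > 1\<close>.\<close>
    have "1 - local_root f p i * of_nat p powr (- s) \<noteq> 0" if i: "i < deg f" for i
    proof
      assume "1 - local_root f p i * of_nat p powr (- s) = 0"
      then have "norm (local_root f p i * of_nat p powr (- s)) = 1"
        by (metis eq_iff_diff_eq_0 norm_one)
      moreover have "norm (of_nat p powr (- s)) = real p powr (- Re s)"
        using p by (simp add: norm_powr_real_powr)
      moreover have "norm (local_root f p i) < real p"
        using f p i by (simp add: is_L_function_def)
      moreover have "real p powr (- Re s) > 0"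
        using p by (simp add: prime_gt_0_nat)
      moreover have "real p * real p powr (- Re s) < 1"
      proof -
        have "real p * real p powr (- Re s) = real p powr (1 - Re s)"
          using p by (simp add: powr_diff powr_minus prime_gt_0_nat field_simps)
        also have "\<dots> < 1"
          using prime_gt_1_nat[OF p] s by (intro powr_less_one) auto
        finally show ?thesis .
      qed
      ultimately show False
        using mult_strict_right_mono[of "norm (local_root f p i)" "real p" "real p powr (- Re s)"]
        by (simp add: norm_mult)
    qed
    then show ?thesis
      by (simp add: euler_factor_def)
  qed
  then show ?thesis
    using has_prod_eq_0_iff[OF prod] by (auto split: if_splits)
qed

text \<open>By the identity theorem, zeros of a nonconstant holomorphic function on a connected open
  set do not accumulate there. In the constant case the Euler product excludes the constant
  0.\<close>

lemma finite_completed_zeros_compact: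
  assumes f: "is_L_function f" and K: "compact K" "K \<subseteq> - {0, 1}"
  shows "finite {z \<in> K. completed f z = 0}"
proof (cases "completed f constant_on (- {0, 1})")
  case True
  \<comment> \<open>\<open>L_value f 2\<close> is a multiple of
    \<open>completed f 2\<close>.\<close>
  have "completed f 2 \<noteq> 0"
    using L_value_nonzero[OF f, of 2] by (auto simp: L_value_def)
  moreover have "completed f z = completed f 2" if "z \<in> K" for z
    using True K(2) that unfolding constant_on_def by force
  ultimately have "{z \<in> K. completed f z = 0} = {}"
    by auto
  then show ?thesis
    by (metis finite.emptyI)
next
  case False
  have "connected (UNIV - {0, 1 :: complex})"
    by (rule connected_open_diff_countable) auto
  then have "connected (- {0, 1 :: complex})"
    by (simp add: Compl_eq_Diff_UNIV)
  moreover have "completed f holomorphic_on (- {0, 1})"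
    using f by (simp add: is_L_function_def)
  moreover have "open (- {0, 1 :: complex})"
    by (intro open_Compl) auto
  ultimately show ?thesis
    using holomorphic_compact_finite_zeros K False by blast
qed

text \<open>Under \<open>GRH\<close> the zeros in the window lie on a compact segment of the
  critical line, which avoids 0 and 1. Each zero carries finitely many indices because its order is
  an integer.\<close>

lemma finite_zero_index_window:
  assumes f: "is_L_function f" and RH: "GRH f" and c: "c > 0"
  shows "finite {j \<in> zero_index f. ordinate j * c \<in> {-\<tau>..\<tau>}}"
proof -
  define K where "K = cbox (Complex (1/2) (- \<tau> / c)) (Complex (1/2) (\<tau> / c))"
  have "compact K"
    unfolding K_def by (rule compact_cbox)
  moreover have K: "K \<subseteq> - {0, 1}"
    unfolding K_def by (auto simp: in_cbox_complex_iff)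
  ultimately have fin: "finite {z \<in> K. completed f z = 0}"
    by (rule finite_completed_zeros_compact[OF f])
  have hol: "completed f holomorphic_on (- {0, 1})"
    using f by (simp add: is_L_function_def)
  have "{j \<in> zero_index f. ordinate j * c \<in> {-\<tau>..\<tau>}} \<subseteq>
      (SIGMA \<rho>:{z \<in> K. completed f z = 0}. {k. int k < zorder (completed f) \<rho>})"
  proof (clarsimp simp: zero_index_def ordinate_def)
    fix \<rho> k
    assume \<rho>: "\<rho> \<in> nontrivial_zeros f" and window: "- \<tau> \<le> Im \<rho> * c" "Im \<rho> * c \<le> \<tau>"
    have "Re \<rho> = 1 / 2"
      using RH \<rho> by (simp add: GRH_def)
    then have "\<rho> \<in> K"
      using window c by (simp add: K_def in_cbox_complex_iff field_simps)
    \<comment> \<open>Zeros are defined through \<open>zorder\<close>; at a point of analyticity a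
      nonzero value forces order 0.\<close>
    moreover have "completed f \<rho> = 0"
    proof (rule ccontr)
      assume nz: "completed f \<rho> \<noteq> 0"
      have "completed f analytic_on {\<rho>}"
        unfolding analytic_at using hol K \<open>\<rho> \<in> K\<close>
        by (intro exI[of _ "- {0, 1}"]) (auto intro!: open_Compl)
      then have "zorder (completed f) \<rho> = 0"
        using nz by (rule zorder_eq_0I)
      then show False
        using \<rho> by (simp add: nontrivial_zeros_def)
    qed
    ultimately show "\<rho> \<in> K \<and> completed f \<rho> = 0"
      by simp
  qed
  moreover have "finite {k. int k < n}" for n
    by (rule finite_subset[of _ "{..<nat n}"]) auto
  ultimately show ?thesis
    using fin by (meson finite_SigmaI finite_subset)
qed

section \<open>Sums over zeros compared with window counts\<close>

text \<open>Terms outside the window are nonpositive, so dropping them can only raise the sum; each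
  remaining term is at most \<open>m\<close>.\<close>

lemma infsum_le_count_window:
  fixes \<phi> :: "real \<Rightarrow> real" and g :: "'a \<Rightarrow> real"
  assumes sum: "(\<lambda>j. \<phi> (g j)) summable_on J"
    and fin: "finite {j \<in> J. g j \<in> {-\<tau>..\<tau>}}"
    and neg: "\<And>x. \<bar>x\<bar> \<ge> \<tau> \<Longrightarrow> \<phi> x \<le> 0" and max: "\<And>x. \<phi> x \<le> m"
  shows "(\<Sum>\<^sub>\<infinity>j\<in>J. \<phi> (g j)) \<le> m * real (card {j \<in> J. g j \<in> {-\<tau>..\<tau>}})"
proof -
  let ?S = "{j \<in> J. g j \<in> {-\<tau>..\<tau>}}"
  have "(\<Sum>\<^sub>\<infinity>j\<in>J. \<phi> (g j)) \<le> (\<Sum>\<^sub>\<infinity>j\<in>?S. \<phi> (g j))"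
    by (rule infsum_mono_neutral) (use sum fin in \<open>auto intro!: neg\<close>)
  also have "\<dots> = (\<Sum>j\<in>?S. \<phi> (g j))"
    using fin by (rule infsum_finite)
  also have "\<dots> \<le> m * real (card ?S)"
    using sum_bounded_above[of ?S "\<lambda>j. \<phi> (g j)" m] max by (simp add: mult.commute)
  finally show ?thesis .
qed

text \<open>The window gives a finite partial sum of a convergent nonnegative series, and each of
  its terms is at least \<open>m\<close>.\<close>

lemma count_window_le_infsum:
  fixes \<psi> :: "real \<Rightarrow> real" and g :: "'a \<Rightarrow> real"
  assumes sum: "(\<lambda>j. \<psi> (g j)) summable_on J"
    and fin: "finite {j \<in> J. g j \<in> {-\<tau>..\<tau>}}"
    and nonneg: "\<And>x. \<psi> x \<ge> 0" and min: "\<And>x. \<bar>x\<bar> \<le> \<tau> \<Longrightarrow> m \<le> \<psi> x"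
  shows "m * real (card {j \<in> J. g j \<in> {-\<tau>..\<tau>}}) \<le> (\<Sum>\<^sub>\<infinity>j\<in>J. \<psi> (g j))"
proof -
  let ?S = "{j \<in> J. g j \<in> {-\<tau>..\<tau>}}"
  have "m * real (card ?S) \<le> (\<Sum>j\<in>?S. \<psi> (g j))"
    using sum_bounded_below[of ?S m "\<lambda>j. \<psi> (g j)"] min by (simp add: mult.commute abs_le_iff)
  also have "\<dots> \<le> (\<Sum>\<^sub>\<infinity>j\<in>J. \<psi> (g j))"
    by (rule finite_sum_le_infsum) (use sum fin nonneg in auto)
  finally show ?thesis .
qed

lemma family_avg_mono:
  assumes "\<And>f. f \<in> A \<Longrightarrow> g f \<le> h f"
  shows "family_avg A g \<le> family_avg A h"
  unfolding family_avg_def by (intro mult_left_mono sum_mono assms) auto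

lemma family_avg_cmult: "family_avg A (\<lambda>f. c * g f) = c * family_avg A g"
  by (simp add: family_avg_def sum_distrib_left mult.left_commute)

section \<open>Positivity of the scaling factors\<close>

text \<open>The shift by 3 in each of the at least one gamma terms makes the analytic conductor at
  least 3, so its logarithm is positive.\<close>

lemma local_scale_pos:
  assumes "is_L_function f"
  shows "local_scale f > 0"
proof -
  have d: "deg f \<ge> 1" and N: "conductor f \<ge> 1"
    using assms by (auto simp: is_L_function_def)
  have "3 ^ 1 \<le> (3 :: real) ^ deg f"
    using d by (intro power_increasing) auto
  also have "\<dots> = (\<Prod>i<deg f. 3)"
    by simp
  also have "\<dots> \<le> (\<Prod>i<deg f. (norm (gamma_shift f i) + 3))"
    by (intro prod_mono) auto
  also have "\<dots> \<le> analytic_conductor f"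
    unfolding analytic_conductor_def using N mult_right_mono[of 1 "real (conductor f)"]
    by (simp add: prod_nonneg)
  finally show ?thesis
    by (simp add: local_scale_def)
qed

lemma global_scale_pos:
  assumes "finite A" "A \<noteq> {}" "\<And>f. f \<in> A \<Longrightarrow> is_L_function f"
  shows "global_scale A > 0"
  unfolding global_scale_def family_avg_def using assms
  by (intro mult_pos_pos sum_pos) (auto simp: local_scale_pos card_gt_0_iff)

text \<open>Monotonicity is given only on the open interval: continuity extends the bound to 0 and
  \<tau>, evenness to negative arguments.\<close>

lemma antimono_on_even_lower_bound:
  fixes \<psi> :: "real \<Rightarrow> real"
  assumes even: "\<And>x. \<psi> (- x) = \<psi> x" and cont: "continuous_on UNIV \<psi>"
    and anti: "antimono_on {0<..<\<tau>} \<psi>" and \<tau>: "\<tau> > 0" and x: "\<bar>x\<bar> \<le> \<tau>"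
  shows "\<psi> \<tau> \<le> \<psi> x"
proof -
  have isCont: "isCont \<psi> y" for y
    using cont by (simp add: continuous_on_eq_continuous_at)
  \<comment> \<open>Let \<open>z\<close> increase to \<tau> in
    \<open>\<psi> z \<le> \<psi> y\<close>.\<close>
  have interior: "\<psi> \<tau> \<le> \<psi> y" if y: "0 < y" "y < \<tau>" for y
  proof (rule tendsto_upperbound)
    show "(\<psi> \<longlongrightarrow> \<psi> \<tau>) (at_left \<tau>)"
      using isCont[of \<tau>] by (simp add: isCont_def filterlim_at_split)
    have "\<forall>\<^sub>F z in at_left \<tau>. z \<in> {y<..<\<tau>}"
      using y by (intro eventually_at_left_real)
    then show "\<forall>\<^sub>F z in at_left \<tau>. \<psi> z \<le> \<psi> y"
      by eventually_elim (use y in \<open>auto intro: monotone_onD[OF anti]\<close>)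
  qed simp
  have "\<psi> \<tau> \<le> \<psi> 0"
  proof (rule tendsto_lowerbound)
    show "(\<psi> \<longlongrightarrow> \<psi> 0) (at_right 0)"
      using isCont[of 0] by (simp add: isCont_def filterlim_at_split)
    have "\<forall>\<^sub>F z in at_right 0. z \<in> {0<..<\<tau>}"
      using \<tau> by (intro eventually_at_right_real)
    then show "\<forall>\<^sub>F z in at_right 0. \<psi> \<tau> \<le> \<psi> z"
      by eventually_elim (auto intro: interior)
  qed simp
  moreover have "\<psi> \<bar>x\<bar> = \<psi> x"
    using even by (simp add: abs_if)
  ultimately show ?thesis
    using interior[of "\<bar>x\<bar>"] x by (cases "x = 0 \<or> \<bar>x\<bar> = \<tau>") auto
qed

section \<open>Transfer of the error term\<close>

text \<open>The constants \<open>k\<close> and \<open>m\<close> are kept apart because the upper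
  bound divides by \<open>\<psi> \<tau>\<close> while its error term is stated with
  \<open>\<psi> 0\<close>; the O-constant absorbs the ratio.\<close>

lemma bigo_divide_const:
  fixes D :: "real \<Rightarrow> real"
  assumes "(\<lambda>R. D R - X) \<in> O[at_top](\<lambda>R. ln (ln R) / ln R)" and "k \<noteq> 0"
  shows "(\<lambda>R. (D R - X) / m) \<in> O[at_top](\<lambda>R. ln (ln R) / (k * ln R))"
proof -
  have "(\<lambda>R. inverse m * (D R - X)) \<in> O[at_top](\<lambda>R. inverse k * (ln (ln R) / ln R))"
    using assms by (simp del: times_divide_eq_right)
  then show ?thesis
    by (simp add: divide_inverse mult_ac)
qed

text \<open>The witness for the error is the error of the density divided by \<open>m\<close>, so
  that main term plus error is exactly \<open>D R / m\<close>.\<close>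

lemma ge_up_to_O_divide:
  assumes "(\<lambda>R. D R - X) \<in> O[at_top](\<lambda>R. ln (ln R) / ln R)" and "k \<noteq> 0" and m: "m > 0"
    and le: "\<forall>\<^sub>F R in at_top. D R \<le> m * Z R"
  shows "ge_up_to_O Z (X / m) (\<lambda>R. ln (ln R) / (k * ln R))"
  unfolding ge_up_to_O_def
proof (intro exI conjI)
  show "(\<lambda>R. (D R - X) / m) \<in> O[at_top](\<lambda>R. ln (ln R) / (k * ln R))"
    using assms(1,2) by (rule bigo_divide_const)
  show "\<forall>\<^sub>F R in at_top. X / m + (D R - X) / m \<le> Z R"
    using le by eventually_elim (use m in \<open>simp add: field_simps\<close>)
qed

lemma le_up_to_O_divide:
  assumes "(\<lambda>R. D R - X) \<in> O[at_top](\<lambda>R. ln (ln R) / ln R)" and "k \<noteq> 0" and m: "m > 0"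
    and le: "\<forall>\<^sub>F R in at_top. m * Z R \<le> D R"
  shows "le_up_to_O Z (X / m) (\<lambda>R. ln (ln R) / (k * ln R))"
  unfolding le_up_to_O_def
proof (intro exI conjI)
  show "(\<lambda>R. (D R - X) / m) \<in> O[at_top](\<lambda>R. ln (ln R) / (k * ln R))"
    using assms(1,2) by (rule bigo_divide_const)
  show "\<forall>\<^sub>F R in at_top. Z R \<le> X / m + (D R - X) / m"
    using le by eventually_elim (use m in \<open>simp add: field_simps\<close>)
qed

section \<open>The two bounds in both normalizations\<close>

theorem theorem3p1:
  fixes F :: "real \<Rightarrow> lfunction set" and \<sigma> \<tau> a b :: real
  assumes family: "\<forall>\<^sub>F R in at_top. finite (F R) \<and> F R \<noteq> {} \<and> (\<forall>f\<in>F R. is_L_function f)"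
    and GRH: "\<forall>\<^sub>F R in at_top. \<forall>f\<in>F R. GRH f"
    and "\<sigma> > 0" and "\<tau> > 0"
    and density_local: "\<And>\<phi>. test_function F \<sigma> \<phi> \<Longrightarrow>
      (\<lambda>R. D_local (F R) \<phi> - (a * \<phi> 0 + b * fourier0 \<phi>)) \<in> O[at_top](\<lambda>R. ln (ln R) / ln R)"
    and density_global: "\<And>\<phi>. test_function F \<sigma> \<phi> \<Longrightarrow>
      (\<lambda>R. D_global (F R) \<phi> - (a * \<phi> 0 + b * fourier0 \<phi>)) \<in> O[at_top](\<lambda>R. ln (ln R) / ln R)"
  shows
    "(\<forall>\<phi>. test_function F \<sigma> \<phi> \<and> \<phi> 0 \<noteq> 0 \<and>
          (\<forall>x. \<bar>x\<bar> \<le> \<tau> \<longrightarrow> \<phi> x \<ge> 0) \<and> (\<forall>x. \<bar>x\<bar> \<ge> \<tau> \<longrightarrow> \<phi> x \<le> 0) \<and>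
          (\<forall>x. \<phi> x \<le> \<phi> 0) \<longrightarrow>
        ge_up_to_O (\<lambda>R. Z_global (F R) \<tau>) (a + b * (fourier0 \<phi> / \<phi> 0))
                   (\<lambda>R. ln (ln R) / (\<phi> 0 * ln R)) \<and>
        ge_up_to_O (\<lambda>R. Z_local (F R) \<tau>) (a + b * (fourier0 \<phi> / \<phi> 0))
                   (\<lambda>R. ln (ln R) / (\<phi> 0 * ln R)))
     \<and>
     (\<forall>\<psi>. test_function F \<sigma> \<psi> \<and> \<psi> \<tau> \<noteq> 0 \<and>
          (\<forall>x. \<psi> x \<ge> 0) \<and> antimono_on {0<..<\<tau>} \<psi> \<longrightarrow>
        le_up_to_O (\<lambda>R. Z_global (F R) \<tau>)
                   (a + (a * (\<psi> 0 - \<psi> \<tau>) + b * fourier0 \<psi>) / \<psi> \<tau>)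
                   (\<lambda>R. ln (ln R) / (\<psi> 0 * ln R)) \<and>
        le_up_to_O (\<lambda>R. Z_local (F R) \<tau>)
                   (a + (a * (\<psi> 0 - \<psi> \<tau>) + b * fourier0 \<psi>) / \<psi> \<tau>)
                   (\<lambda>R. ln (ln R) / (\<psi> 0 * ln R)))"
proof (intro conjI allI impI; elim conjE)
  \<comment> \<open>For large \<open>R\<close>, both library defaults are excluded: the windows are
    finite, so \<open>card\<close> really counts, and the zero sums converge, so
    \<open>infsum\<close> is a genuine sum.\<close>
  have ev: "\<forall>\<^sub>F R in at_top.
      (\<forall>f\<in>F R. finite {j \<in> zero_index f. ordinate j * local_scale f \<in> {-\<tau>..\<tau>}} \<and>
         finite {j \<in> zero_index f. ordinate j * global_scale (F R) \<in> {-\<tau>..\<tau>}} \<and>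
        (\<lambda>j. \<phi> (ordinate j * local_scale f)) summable_on zero_index f \<and>
        (\<lambda>j. \<phi> (ordinate j * global_scale (F R))) summable_on zero_index f)"
    if "test_function F \<sigma> \<phi>" for \<phi>
  proof -
    from that have "zero_sums_converge F \<phi>"
      by (simp add: test_function_def)
    with family GRH show ?thesis
      unfolding zero_sums_converge_def
      by eventually_elim
        (auto intro!: finite_zero_index_window local_scale_pos global_scale_pos
              simp del: atLeastAtMost_iff)
  qed
  {
    fix \<phi>
    assume \<phi>: "test_function F \<sigma> \<phi>" "\<phi> 0 \<noteq> 0" "\<forall>x. \<bar>x\<bar> \<le> \<tau> \<longrightarrow> 0 \<le> \<phi> x"
      "\<forall>x. \<tau> \<le> \<bar>x\<bar> \<longrightarrow> \<phi> x \<le> 0" "\<forall>x. \<phi> x \<le> \<phi> 0"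
    then have pos: "\<phi> 0 > 0"
      using \<open>\<tau> > 0\<close> by (metis abs_zero less_le)
    \<comment> \<open>This is the main term of the density divided by the maximum of \<phi>.\<close>
    have main: "a + b * (fourier0 \<phi> / \<phi> 0) = (a * \<phi> 0 + b * fourier0 \<phi>) / \<phi> 0"
      using pos by (simp add: field_simps)
    show "ge_up_to_O (\<lambda>R. Z_global (F R) \<tau>) (a + b * (fourier0 \<phi> / \<phi> 0))
        (\<lambda>R. ln (ln R) / (\<phi> 0 * ln R))"
      unfolding main
    proof (rule ge_up_to_O_divide[OF density_global[OF \<phi>(1)] \<phi>(2) pos])
      show "\<forall>\<^sub>F R in at_top. D_global (F R) \<phi> \<le> \<phi> 0 * Z_global (F R) \<tau>"
        \<comment> \<open>Moving the factor \<open>\<phi> 0\<close> inside the average reduces the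
          claim to a comparison for each single L-function.\<close>
        using ev[OF \<phi>(1)] unfolding D_global_def Z_global_def family_avg_cmult[symmetric]
        by eventually_elim (use \<phi> in \<open>auto intro!: family_avg_mono infsum_le_count_window
              simp del: atLeastAtMost_iff\<close>)
    qed
    show "ge_up_to_O (\<lambda>R. Z_local (F R) \<tau>) (a + b * (fourier0 \<phi> / \<phi> 0))
        (\<lambda>R. ln (ln R) / (\<phi> 0 * ln R))"
      unfolding main
    proof (rule ge_up_to_O_divide[OF density_local[OF \<phi>(1)] \<phi>(2) pos])
      show "\<forall>\<^sub>F R in at_top. D_local (F R) \<phi> \<le> \<phi> 0 * Z_local (F R) \<tau>"
        using ev[OF \<phi>(1)] unfolding D_local_def Z_local_def family_avg_cmult[symmetric]
        by eventually_elim (use \<phi> in \<open>auto intro!: family_avg_mono infsum_le_count_window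
              simp del: atLeastAtMost_iff\<close>)
    qed
  next
    fix \<psi>
    assume \<psi>: "test_function F \<sigma> \<psi>" "\<psi> \<tau> \<noteq> 0" "\<forall>x. 0 \<le> \<psi> x" "antimono_on {0<..<\<tau>} \<psi>"
    then have pos: "\<psi> \<tau> > 0"
      by (metis less_le)
    have "continuous_on UNIV \<psi>"
      using \<psi>(1) unfolding test_function_def twice_cont_diff_def
      by (meson DERIV_isCont continuous_at_imp_continuous_on)
    then have lower: "\<psi> \<tau> \<le> \<psi> x" if "\<bar>x\<bar> \<le> \<tau>" for x
      using \<psi>(1,4) \<open>\<tau> > 0\<close> that
      by (intro antimono_on_even_lower_bound[of \<psi> \<tau> x]) (simp_all add: test_function_def)
    \<comment> \<open>Needed because the error term has \<open>\<psi> 0\<close> in its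
      denominator.\<close>
    have nz: "\<psi> 0 \<noteq> 0"
      using lower[of 0] pos \<open>\<tau> > 0\<close> by auto
    \<comment> \<open>The leading \<open>a\<close> cancels against
      \<open>- a * \<psi> \<tau>\<close> in the numerator, leaving the main term of the density over
      \<open>\<psi> \<tau>\<close>.\<close>
    have main: "a + (a * (\<psi> 0 - \<psi> \<tau>) + b * fourier0 \<psi>) / \<psi> \<tau> =
        (a * \<psi> 0 + b * fourier0 \<psi>) / \<psi> \<tau>"
      using pos by (simp add: field_simps)
    show "le_up_to_O (\<lambda>R. Z_global (F R) \<tau>)
        (a + (a * (\<psi> 0 - \<psi> \<tau>) + b * fourier0 \<psi>) / \<psi> \<tau>)
        (\<lambda>R. ln (ln R) / (\<psi> 0 * ln R))"
      unfolding main
    proof (rule le_up_to_O_divide[OF density_global[OF \<psi>(1)] nz pos])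
      show "\<forall>\<^sub>F R in at_top. \<psi> \<tau> * Z_global (F R) \<tau> \<le> D_global (F R) \<psi>"
        using ev[OF \<psi>(1)] unfolding D_global_def Z_global_def family_avg_cmult[symmetric]
        by eventually_elim (use \<psi> lower in \<open>auto intro!: family_avg_mono count_window_le_infsum
              simp del: atLeastAtMost_iff\<close>)
    qed
    show "le_up_to_O (\<lambda>R. Z_local (F R) \<tau>)
        (a + (a * (\<psi> 0 - \<psi> \<tau>) + b * fourier0 \<psi>) / \<psi> \<tau>)
        (\<lambda>R. ln (ln R) / (\<psi> 0 * ln R))"
      unfolding main
    proof (rule le_up_to_O_divide[OF density_local[OF \<psi>(1)] nz pos])
      show "\<forall>\<^sub>F R in at_top. \<psi> \<tau> * Z_local (F R) \<tau> \<le> D_local (F R) \<psi>"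
        using ev[OF \<psi>(1)] unfolding D_local_def Z_local_def family_avg_cmult[symmetric]
        by eventually_elim (use \<psi> lower in \<open>auto intro!: family_avg_mono count_window_le_infsum
              simp del: atLeastAtMost_iff\<close>)
    qed
  }
qed

end
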